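(* Let $0<s_{\min}<s_{\max}$, $L>0$, $\tau>2$, and assume $m\le n^{1/(1+2s_{\max})}$ (where $m=m_n$ may depend on $n$). Consider the two-round interactive distributed protocol described in the context, and let $\hat B_k$ be the total number of bits transmitted between the $k$th local machine and the central machine, $k\in\{1,\dots,m\}$. Then for every $s\in(s_{\min},s_{\max})$ there is a constant $C>0$, not depending on $n$, $m$ and $k$, such that $$\inf_{f_0\in B^s_{2,\infty}(L)}P_{f_0}\Big(\hat B_k\le C\log(n)\,n^{1/(1+2s)}\Big)\longrightarrow 1\qquad\text{as } n\to\infty.$$
   Context: Model. Let $\{\psi_{ij}: i\ge 0,\ j=0,\dots,2^i-1\}$ be a fixed orthonormal (boundary-corrected Cohen–Daubechies–Vial) wavelet basis of $L^2[0,1]$, and write $f_0=\sum_{i\ge0}\sum_{j=0}^{2^i-1}\theta_{0,ij}\psi_{ij}$. In the distributed signal-in-white-noise model with $m$ machines and total sample size (signal-to-noise parameter) $n$, machine $k\in\{1,\dots,m\}$ observes $$y_{ij}^{(k)}=\theta_{0,ij}+\sqrt{\tfrac mn}\,Z_{ij}^{(k)},\qquad i\ge0,\ j=0,\dots,2^i-1,$$ with $Z_{ij}^{(k)}$ i.i.d. $N(0,1)$ over all $i,j,k$. $P_{f_0}$ denotes probability under this model. Besov ball. $f_0\in B^s_{2,\infty}(L)$ means that its coefficient sequence $\theta_0$ is in $\ell_2$ and $\sup_{i\ge0}2^{2is}\sum_{j=0}^{2^i-1}\theta_{0,ij}^2\le L$. Truncation level. Put $T_i^{(k)}=2^{-i}\sum_{j=0}^{2^i-1}(y_{ij}^{(k)})^2$,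 $T_i=\frac1m\sum_{k=1}^mT_i^{(k)}$ and $\widetilde T_i=2^iT_i-2^i m/n$. Let $\mathcal L$ be the set of integers in $\big[\frac{\log_2 n}{1+2s_{\max}},\frac{\log_2 n}{1+2s_{\min}}\big]$. Define $$\hat\ell=\min\Big\{\ell\in\mathcal L:\ \sum_{i=\ell}^{l}\widetilde T_i\le \tau 2^l/n\ \text{ for all } l\in\mathcal L,\ l\ge\ell\Big\},$$ with $\hat\ell=\lfloor\log_2(n)/(1+2s_{\min})\rfloor$ if this set is empty. Protocol. Round 1: each machine $k$ transmits the numbers $T_i^{(k)}$, $i\in\mathcal L$, to the central machine, which computes $\hat\ell$ and broadcasts this integer to the local machines. Round 2: each machine $k$ transmits $y_{ij}^{(k)}$ for all $0\le i\le\hat\ell$, $j=0,\dots,2^i-1$; the central machine forms $\hat f_n=\sum_{0\le i\le\hat\ell}\sum_{j=0}^{2^i-1}\big(\frac1m\sum_{k=1}^my_{ij}^{(k)}\big)\psi_{ij}$. Bit counting. Every transmitted real number $x$ is sent as a finite binary approximation with precision $n^{-D}$, where $D>0$ is an arbitrary fixed constant (e.g. sign, binary digits of the integer part, and the first $\lceil D\log_2 n\rceil$ binary digits of the fractional part), so that its transmission costs at most $c_D\big(\log_2 n+\log_2(1\vee|x|)\big)$ bits for $n\ge 2$, with $c_D$ depending only on $D$; in particular a bounded quantity costs $O(D\log n)$ bits. The integer $\hat\ell$ is sent by its binary expansion. $\hat\ell$ is taken to be the level computed from the exact statistics $T_i$. $\hat B_k$ is the sum of the bits over both rounds. *)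

theory Defs
  imports "HOL-Probability.Probability" "HOL-Library.Log_Nat"
begin

subsection \<open>Orthonormal bases of \<open>L\<^sup>2[0,1]\<close> and Besov balls\<close>

abbreviation unit_leb :: "real measure" where
  "unit_leb \<equiv> lebesgue_on {0..1}"

definition L2_unit :: "(real \<Rightarrow> real) set" where
  "L2_unit = {f \<in> borel_measurable unit_leb. integrable unit_leb (\<lambda>x. (f x)\<^sup>2)}"

definition coeff_of :: "(nat \<Rightarrow> nat \<Rightarrow> real \<Rightarrow> real) \<Rightarrow> (real \<Rightarrow> real) \<Rightarrow> nat \<Rightarrow> nat \<Rightarrow> real" where
  "coeff_of \<psi> f i j = (LINT x|unit_leb. f x * \<psi> i j x)"

text \<open>Only the functions \<open>\<psi> i j\<close> with \<open>j < 2 ^ i\<close> belong to the basis. The boundary-corrected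
  wavelet bases of Cohen, Daubechies and Vial are instances; nothing but the orthonormal basis
  property enters the model.\<close>

definition orthonormal_basis :: "(nat \<Rightarrow> nat \<Rightarrow> real \<Rightarrow> real) \<Rightarrow> bool" where
  "orthonormal_basis \<psi> \<longleftrightarrow>
     (\<forall>i. \<forall>j<2 ^ i. \<psi> i j \<in> L2_unit) \<and>
     (\<forall>i i'. \<forall>j<2 ^ i. \<forall>j'<2 ^ i'.
        (LINT x|unit_leb. \<psi> i j x * \<psi> i' j' x) = (if i = i' \<and> j = j' then 1 else 0)) \<and>
     (\<forall>f\<in>L2_unit.
        (\<lambda>N. LINT x|unit_leb. (f x - (\<Sum>i<N. \<Sum>j<2 ^ i. coeff_of \<psi> f i j * \<psi> i j x))\<^sup>2)
          \<longlonglongrightarrow> 0)"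

definition besov_ball :: "(nat \<Rightarrow> nat \<Rightarrow> real \<Rightarrow> real) \<Rightarrow> real \<Rightarrow> real \<Rightarrow> (real \<Rightarrow> real) set" where
  "besov_ball \<psi> s L = {f \<in> L2_unit.
     summable (\<lambda>i. \<Sum>j<2 ^ i. (coeff_of \<psi> f i j)\<^sup>2) \<and>
     (SUP i::nat. ereal (2 powr (2 * real i * s) * (\<Sum>j<2 ^ i. (coeff_of \<psi> f i j)\<^sup>2))) \<le> ereal L}"


subsection \<open>The distributed signal-in-white-noise model\<close>

text \<open>Indices are triples \<open>(k, i, j)\<close>: machine, level, position.\<close>

definition noise :: "nat \<Rightarrow> (nat \<times> nat \<times> nat \<Rightarrow> real) measure" where
  "noise m = PiM {(k, i, j). k \<in> {1..m} \<and> j < 2 ^ i} (\<lambda>_. density lborel std_normal_density)"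

definition observation ::
  "nat \<Rightarrow> nat \<Rightarrow> (nat \<Rightarrow> nat \<Rightarrow> real) \<Rightarrow> (nat \<times> nat \<times> nat \<Rightarrow> real) \<Rightarrow> nat \<Rightarrow> nat \<Rightarrow> nat \<Rightarrow> real" where
  "observation n m \<theta> z k i j = \<theta> i j + sqrt (real m / real n) * z (k, i, j)"


subsection \<open>The truncation level\<close>

definition T_local :: "(nat \<Rightarrow> nat \<Rightarrow> nat \<Rightarrow> real) \<Rightarrow> nat \<Rightarrow> nat \<Rightarrow> real" where
  "T_local y k i = (\<Sum>j<2 ^ i. (y k i j)\<^sup>2) / 2 ^ i"

definition T_avg :: "nat \<Rightarrow> (nat \<Rightarrow> nat \<Rightarrow> nat \<Rightarrow> real) \<Rightarrow> nat \<Rightarrow> real" where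
  "T_avg m y i = (\<Sum>k=1..m. T_local y k i) / real m"

definition T_tilde :: "nat \<Rightarrow> nat \<Rightarrow> (nat \<Rightarrow> nat \<Rightarrow> nat \<Rightarrow> real) \<Rightarrow> nat \<Rightarrow> real" where
  "T_tilde n m y i = 2 ^ i * T_avg m y i - 2 ^ i * real m / real n"

definition levels :: "real \<Rightarrow> real \<Rightarrow> nat \<Rightarrow> nat set" where
  "levels smin smax n =
     {l. log 2 (real n) / (1 + 2 * smax) \<le> real l \<and> real l \<le> log 2 (real n) / (1 + 2 * smin)}"

definition admissible_levels ::
  "real \<Rightarrow> real \<Rightarrow> real \<Rightarrow> nat \<Rightarrow> nat \<Rightarrow> (nat \<Rightarrow> nat \<Rightarrow> nat \<Rightarrow> real) \<Rightarrow> nat set" where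
  "admissible_levels smin smax \<tau> n m y =
     {l \<in> levels smin smax n. \<forall>l'\<in>levels smin smax n. l \<le> l' \<longrightarrow>
        (\<Sum>i=l..l'. T_tilde n m y i) \<le> \<tau> * 2 ^ l' / real n}"

definition l_hat ::
  "real \<Rightarrow> real \<Rightarrow> real \<Rightarrow> nat \<Rightarrow> nat \<Rightarrow> (nat \<Rightarrow> nat \<Rightarrow> nat \<Rightarrow> real) \<Rightarrow> nat" where
  "l_hat smin smax \<tau> n m y =
     (if admissible_levels smin smax \<tau> n m y = {}
      then nat \<lfloor>log 2 (real n) / (1 + 2 * smin)\<rfloor>
      else Min (admissible_levels smin smax \<tau> n m y))"


subsection \<open>Bit counting\<close>

text \<open>A binary code for the reals, indexed by the sample size \<open>n\<close>: the codeword \<open>enc n x\<close>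
  determines \<open>x\<close> up to an error \<open>n\<^sup>-\<^sup>D\<close>, and its length is at most
  \<open>c (log\<^sub>2 n + log\<^sub>2 (max 1 \<bar>x\<bar>))\<close>. Sending the sign, the binary digits of the integer part and
  \<open>\<lceil>D log\<^sub>2 n\<rceil>\<close> fractional digits is an example. Measurability of the encoder makes the number of
  transmitted bits a random variable.\<close>

definition real_code :: "real \<Rightarrow> real \<Rightarrow> (nat \<Rightarrow> real \<Rightarrow> bool list) \<Rightarrow> bool" where
  "real_code D c enc \<longleftrightarrow> (\<forall>n\<ge>2.
     enc n \<in> borel \<rightarrow>\<^sub>M count_space UNIV \<and>
     (\<exists>dec. \<forall>x. \<bar>dec (enc n x) - x\<bar> \<le> real n powr (- D)) \<and>
     (\<forall>x. real (length (enc n x)) \<le> c * (log 2 (real n) + log 2 (max 1 \<bar>x\<bar>))))"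

text \<open>The binary expansion of \<open>0\<close> is the single digit \<open>0\<close>, whereas \<^term>\<open>floorlog 2 0 = 0\<close>.\<close>

definition nat_bits :: "nat \<Rightarrow> nat" where
  "nat_bits l = max 1 (floorlog 2 l)"

text \<open>The three summands are the first-round message of machine \<open>k\<close>, the truncation level
  broadcast to it, and its second-round message.\<close>

definition bits ::
  "(nat \<Rightarrow> real \<Rightarrow> bool list) \<Rightarrow> real \<Rightarrow> real \<Rightarrow> real \<Rightarrow> nat \<Rightarrow> nat \<Rightarrow>
     (nat \<Rightarrow> nat \<Rightarrow> nat \<Rightarrow> real) \<Rightarrow> nat \<Rightarrow> nat" where
  "bits enc smin smax \<tau> n m y k =
     (\<Sum>i\<in>levels smin smax n. length (enc n (T_local y k i)))
     + nat_bits (l_hat smin smax \<tau> n m y)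
     + (\<Sum>i\<le>l_hat smin smax \<tau> n m y. \<Sum>j<2 ^ i. length (enc n (y k i j)))"

end

theory Submission imports Defs "HOL-Real_Asymp.Real_Asymp" begin

text \<open>Let \<open>2 ^ l\<close> be of the order \<open>n powr (1 / (1 + 2 * s))\<close>, large enough for the energy of \<open>f\<close>
  at the levels \<open>\<ge> l\<close> to be at most \<open>2 ^ l / n\<close>. A sum of statistics \<open>T_tilde\<close> over the levels
  \<open>l, \<dots>, l'\<close> is such an energy plus a centred quadratic polynomial in the noise with variance
  \<open>O(m 2 ^ l' / n\<^sup>2)\<close>. By Chebyshev it exceeds its threshold with probability \<open>O(m / 2 ^ l')\<close>, so a
  union bound over \<open>l'\<close> gives \<open>l_hat \<le> l\<close> up to probability \<open>O(m / 2 ^ l)\<close>, which vanishes because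
  \<open>m \<le> n powr (1 / (1 + 2 * smax))\<close> and \<open>s < smax\<close>. Since \<open>log\<^sub>2 (max 1 \<bar>x\<bar>) \<le> x\<^sup>2\<close>, the part of
  the message length that depends on the magnitudes of the observations is dominated by their
  energy up to level \<open>l\<close>, which Markov's inequality controls up to a factor \<open>log n\<close>.\<close>

subsection \<open>Second moments of Gaussian noise\<close>

text \<open>Independence means that the joint law is the product of the marginal laws. Here the
  joint law of the coordinates is \<open>PiM I M\<close> itself and its marginals are the
  \<open>M i\<close>. The index set may be infinite, as it is for the noise.\<close>

lemma indep_vars_PiM_components:
  assumes M: "\<And>i. i \<in> I \<Longrightarrow> prob_space (M i)"
  assumes f: "\<And>i. i \<in> I \<Longrightarrow> f i \<in> M i \<rightarrow>\<^sub>M N i"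
  assumes "I \<noteq> {}"
  shows "prob_space.indep_vars (PiM I M) N (\<lambda>i \<omega>. f i (\<omega> i)) I"
proof -
  interpret prob_space "PiM I M" by (rule prob_space_PiM) (rule M)
  \<comment> \<open>Points of a product space are extensional, so restricting them to
    \<open>I\<close> changes nothing.\<close>
  have "distr (PiM I M) (PiM I M) (\<lambda>x. \<lambda>i\<in>I. x i) = distr (PiM I M) (PiM I M) (\<lambda>x. x)"
    by (rule distr_cong) (auto simp: space_PiM PiE_def extensional_def restrict_def fun_eq_iff)
  also have "\<dots> = PiM I M" by (rule distr_id)
  also have "\<dots> = PiM I (\<lambda>i. distr (PiM I M) (M i) (\<lambda>x. x i))"
    by (rule PiM_cong) (simp_all add: distr_PiM_component M)
  finally have "indep_vars M (\<lambda>i \<omega>. \<omega> i) I"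
    by (subst indep_vars_iff_distr_eq_PiM') (auto simp: assms(3))
  from indep_vars_compose2[OF this, of f N] f show ?thesis by auto
qed

text \<open>In the expanded square every off-diagonal product has expectation equal to a product of
  two means, hence zero. Square integrability on a probability space supplies the integrability
  needed for this factorisation.\<close>

lemma (in prob_space) second_moment_sum_indep:
  fixes X :: "'i \<Rightarrow> 'a \<Rightarrow> real"
  assumes "finite A" and ind: "indep_vars (\<lambda>_. borel) X A"
    and sq: "\<And>a. a \<in> A \<Longrightarrow> integrable M (\<lambda>x. (X a x)\<^sup>2)"
    and mean: "\<And>a. a \<in> A \<Longrightarrow> expectation (X a) = 0"
  shows "integrable M (\<lambda>x. (\<Sum>a\<in>A. X a x)\<^sup>2)"
    and "expectation (\<lambda>x. (\<Sum>a\<in>A. X a x)\<^sup>2) = (\<Sum>a\<in>A. expectation (\<lambda>x. (X a x)\<^sup>2))"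
proof -
  have rv: "random_variable borel (X a)" if "a \<in> A" for a
    using ind that by (auto simp: indep_vars_def)
  have int: "integrable M (X a)" if "a \<in> A" for a
    using square_integrable_imp_integrable[OF rv sq] that by auto
  have expand: "(\<Sum>a\<in>A. X a x)\<^sup>2 = (\<Sum>a\<in>A. \<Sum>b\<in>A. X a x * X b x)" for x
    by (simp add: power2_eq_square sum_product)
  have pair: "integrable M (\<lambda>x. X a x * X b x) \<and>
      expectation (\<lambda>x. X a x * X b x) = (if a = b then expectation (\<lambda>x. (X a x)\<^sup>2) else 0)"
    if "a \<in> A" "b \<in> A" for a b
  proof (cases "a = b")
    case True
    then show ?thesis using sq[OF that(1)] by (simp add: power2_eq_square)
  next
    case False
    have "indep_vars (\<lambda>_. borel) X {a, b}"
      by (rule indep_vars_subset[OF ind]) (use that in auto)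
    from indep_vars_lebesgue_integral[OF _ this] indep_vars_integrable[OF _ this] int that False mean
    show ?thesis by auto
  qed
  show "integrable M (\<lambda>x. (\<Sum>a\<in>A. X a x)\<^sup>2)"
    unfolding expand using pair by (intro Bochner_Integration.integrable_sum) auto
  have "expectation (\<lambda>x. (\<Sum>a\<in>A. X a x)\<^sup>2) =
      (\<Sum>a\<in>A. \<Sum>b\<in>A. if a = b then expectation (\<lambda>x. (X a x)\<^sup>2) else 0)"
    unfolding expand using pair by (simp add: Bochner_Integration.integral_sum Bochner_Integration.integrable_sum)
  then show "expectation (\<lambda>x. (\<Sum>a\<in>A. X a x)\<^sup>2) = (\<Sum>a\<in>A. expectation (\<lambda>x. (X a x)\<^sup>2))"
    using \<open>finite A\<close> by simp
qed

lemma prob_space_noise: "prob_space (noise m)"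
  unfolding noise_def by (intro prob_space_PiM prob_space_normal_density) simp

definition noise_index :: "nat \<Rightarrow> (nat \<times> nat \<times> nat) set" where
  "noise_index m = {(k, i, j). k \<in> {1..m} \<and> j < 2 ^ i}"

lemma measurable_noise_component:
  assumes "a \<in> noise_index m"
  shows "(\<lambda>z. z a) \<in> borel_measurable (noise m)"
proof -
  have "(\<lambda>z. z a) \<in> noise m \<rightarrow>\<^sub>M density lborel std_normal_density"
    using assms unfolding noise_def noise_index_def by (intro measurable_component_singleton) auto
  then show ?thesis by simp
qed

lemma distr_noise_component:
  assumes "a \<in> noise_index m"
  shows "distr (noise m) borel (\<lambda>z. z a) = std_normal_distribution"
proof -
  have "distr (noise m) borel (\<lambda>z. z a) = distr (noise m) std_normal_distribution (\<lambda>z. z a)"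
    by (rule distr_cong) auto
  also have "\<dots> = std_normal_distribution"
    using assms unfolding noise_def noise_index_def
    by (subst distr_PiM_component) (auto intro!: prob_space_normal_density)
  finally show ?thesis .
qed

text \<open>The moments of orders 0 to 4 are 1, 0, 1, 0, 3. Degree four is enough because the noise
  enters through quadratic polynomials and their squares.\<close>

lemma has_bochner_integral_std_normal_poly4:
  "has_bochner_integral std_normal_distribution
     (\<lambda>x. c0 + c1 * x + c2 * x ^ 2 + c3 * x ^ 3 + c4 * x ^ 4) (c0 + c2 + 3 * c4)"
proof -
  let ?N = "std_normal_distribution"
  interpret prob_space ?N by (rule prob_space_normal_density) simp
  have hb: "has_bochner_integral ?N (\<lambda>x. x ^ k) (integral\<^sup>L ?N (\<lambda>x. x ^ k))" for k
    by (rule has_bochner_integral_integrable[OF integrable_std_normal_distribution_moment])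
  have 1: "integral\<^sup>L ?N (\<lambda>x. x ^ 1) = 0" "integral\<^sup>L ?N (\<lambda>x. x ^ 3) = 0"
    by (rule integral_std_normal_distribution_moment_odd, simp)+
  have 2: "integral\<^sup>L ?N (\<lambda>x. x ^ 2) = 1" "integral\<^sup>L ?N (\<lambda>x. x ^ 4) = 3"
    using std_normal_distribution_even_moments(1)[of 1] std_normal_distribution_even_moments(1)[of 2]
    by (simp_all add: fact_numeral)
  have "has_bochner_integral ?N
     (\<lambda>x. c0 * x ^ 0 + c1 * x ^ 1 + c2 * x ^ 2 + c3 * x ^ 3 + c4 * x ^ 4)
     (c0 * 1 + c1 * 0 + c2 * 1 + c3 * 0 + c4 * 3)"
    using hb[of 0] hb[of 1] hb[of 2] hb[of 3] hb[of 4] prob_space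
    unfolding 1 2 by (intro has_bochner_integral_add has_bochner_integral_mult_right) (auto simp: measure_def)
  then show ?thesis by (simp add: mult.commute)
qed

lemma has_bochner_integral_noise_component:
  fixes f :: "real \<Rightarrow> real"
  assumes "a \<in> noise_index m" and "has_bochner_integral std_normal_distribution f x"
  shows "has_bochner_integral (noise m) (\<lambda>z. f (z a)) x"
proof -
  have [measurable]: "(\<lambda>z. z a) \<in> borel_measurable (noise m)" "f \<in> borel_measurable borel"
    using assms by (auto dest: borel_measurable_has_bochner_integral intro: measurable_noise_component)
  have "has_bochner_integral (distr (noise m) borel (\<lambda>z. z a)) f x"
    using assms by (simp add: distr_noise_component)
  then show ?thesis
    using integrable_distr_eq[of "\<lambda>z. z a" "noise m" borel f] integral_distr[of "\<lambda>z. z a" "noise m" borel f]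
    by (simp add: has_bochner_integral_iff)
qed

text \<open>Chebyshev's inequality for a sum of independent centred terms. The linear and the
  quadratic part of a term are uncorrelated because odd moments vanish, and \<open>z^2 - 1\<close>
  has variance 2.\<close>

lemma prob_gaussian_chaos_le:
  assumes A: "finite A" "A \<subseteq> noise_index m" and "0 < t"
  shows "measure (noise m) {z \<in> space (noise m). t < (\<Sum>a\<in>A. \<alpha> a * z a + \<beta> * ((z a)\<^sup>2 - 1))}
    \<le> (\<Sum>a\<in>A. (\<alpha> a)\<^sup>2 + 2 * \<beta>\<^sup>2) / t\<^sup>2"
proof (cases "A = {}")
  case True
  then show ?thesis using \<open>0 < t\<close> by simp
next
  case False
  interpret prob_space "noise m" by (rule prob_space_noise)
  define X where "X = (\<lambda>a z. \<alpha> a * z a + \<beta> * ((z a :: real)\<^sup>2 - 1))"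
  have "indep_vars (\<lambda>_. borel) X (noise_index m)"
    unfolding noise_def X_def noise_index_def[symmetric]
    by (rule indep_vars_PiM_components[where f = "\<lambda>a x. \<alpha> a * x + \<beta> * (x\<^sup>2 - 1)"])
       (use False A in \<open>auto intro!: prob_space_normal_density\<close>)
  then have ind: "indep_vars (\<lambda>_. borel) X A"
    by (rule indep_vars_subset) (rule A)
  \<comment> \<open>The constant coefficient \<open>- \<beta>\<close> cancels against the quadratic
    coefficient \<open>\<beta>\<close>.\<close>
  have 1: "has_bochner_integral (noise m) (X a) 0" if "a \<in> A" for a
    using has_bochner_integral_noise_component[of a m,
        OF _ has_bochner_integral_std_normal_poly4[of "- \<beta>" "\<alpha> a" \<beta> 0 0]] that A
    by (auto simp: X_def algebra_simps)
  have 2: "has_bochner_integral (noise m) (\<lambda>z. (X a z)\<^sup>2) ((\<alpha> a)\<^sup>2 + 2 * \<beta>\<^sup>2)" if "a \<in> A" for a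
  proof -
    \<comment> \<open>The even coefficients, weighted by the moments 1, 1, 3, add up to
      \<open>\<alpha>^2 + 2 * \<beta>^2\<close>.\<close>
    have *: "(X a z)\<^sup>2 = \<beta>\<^sup>2 + (- 2 * \<alpha> a * \<beta>) * z a + ((\<alpha> a)\<^sup>2 - 2 * \<beta>\<^sup>2) * z a ^ 2
        + 2 * \<alpha> a * \<beta> * z a ^ 3 + \<beta>\<^sup>2 * z a ^ 4" for z
      by (simp add: X_def) algebra
    have "a \<in> noise_index m" using that A by auto
    from has_bochner_integral_noise_component[OF this has_bochner_integral_std_normal_poly4]
    show ?thesis unfolding * by (rule back_subst[where P = "has_bochner_integral _ _"]) simp
  qed
  have m2: "integrable (noise m) (\<lambda>z. (\<Sum>a\<in>A. X a z)\<^sup>2)"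
    "expectation (\<lambda>z. (\<Sum>a\<in>A. X a z)\<^sup>2) = (\<Sum>a\<in>A. (\<alpha> a)\<^sup>2 + 2 * \<beta>\<^sup>2)"
    using second_moment_sum_indep[OF A(1) ind] 1 2
    by (auto simp: has_bochner_integral_iff cong: sum.cong)
  have [measurable]: "X a \<in> borel_measurable (noise m)" if "a \<in> A" for a
    using 1[OF that] by (auto dest: borel_measurable_has_bochner_integral)
  have "prob {z \<in> space (noise m). t < (\<Sum>a\<in>A. X a z)}
      \<le> prob {z \<in> space (noise m). t \<le> \<bar>\<Sum>a\<in>A. X a z\<bar>}"
    by (intro finite_measure_mono) auto
  also have "\<dots> \<le> expectation (\<lambda>z. (\<Sum>a\<in>A. X a z)\<^sup>2) / t\<^sup>2"
    by (rule second_moment_method) (use m2 \<open>0 < t\<close> in auto)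
  finally show ?thesis unfolding m2 by (simp add: X_def)
qed

subsection \<open>The selected truncation level\<close>

lemma measurable_observation:
  assumes "k \<in> {1..m}" and "j < 2 ^ i"
  shows "(\<lambda>z. observation n m \<theta> z k i j) \<in> borel_measurable (noise m)"
proof -
  have [measurable]: "(\<lambda>z. z (k, i, j)) \<in> borel_measurable (noise m)"
    using assms by (intro measurable_noise_component) (auto simp: noise_index_def)
  show ?thesis unfolding observation_def by measurable
qed

lemma measurable_T_local:
  assumes "k \<in> {1..m}"
  shows "(\<lambda>z. T_local (observation n m \<theta> z) k i) \<in> borel_measurable (noise m)"
  unfolding T_local_def using measurable_observation[OF assms]
  by (intro borel_measurable_divide borel_measurable_sum borel_measurable_power) auto

lemma measurable_T_tilde [measurable]:
  "(\<lambda>z. T_tilde n m (observation n m \<theta> z) i) \<in> borel_measurable (noise m)"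
  unfolding T_tilde_def T_avg_def using measurable_T_local
  by (intro borel_measurable_diff borel_measurable_times borel_measurable_divide
      borel_measurable_sum) auto

text \<open>Squaring an observation and writing \<open>z^2\<close> as \<open>1 + (z^2 - 1)\<close>
  leaves a constant \<open>1 / n\<close> for each machine and position. Over one level these add up
  to \<open>2 ^ i * m / n\<close>, which is what \<open>T_tilde\<close> subtracts, so signal energy
  plus centred noise remains.\<close>

lemma T_tilde_sum_decomposition:
  assumes "0 < n" "0 < m"
  shows "(\<Sum>i=l..l'. T_tilde n m (observation n m \<theta> z) i) =
    (\<Sum>i=l..l'. \<Sum>j<2^i. (\<theta> i j)\<^sup>2) +
    (\<Sum>a\<in>{1..m} \<times> Sigma {l..l'} (\<lambda>i. {..<2^i}).
       (case a of (k, i, j) \<Rightarrow> 2 * sqrt (m / n) / m * \<theta> i j) * z a + 1 / n * ((z a)\<^sup>2 - 1))"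
proof -
  let ?g = "\<lambda>k i j. 2 * sqrt (m / n) / m * \<theta> i j * z (k, i, j) + 1 / n * ((z (k, i, j))\<^sup>2 - 1)"
  have pt: "(observation n m \<theta> z k i j)\<^sup>2 / m = (\<theta> i j)\<^sup>2 / m + ?g k i j + 1 / n" for k i j
  proof -
    define r where "r = sqrt (m / n)"
    have r2: "r\<^sup>2 = m / n" unfolding r_def by simp
    have "(observation n m \<theta> z k i j)\<^sup>2 = (\<theta> i j)\<^sup>2 + 2 * r * \<theta> i j * z (k, i, j) + r\<^sup>2 * (z (k, i, j))\<^sup>2"
      unfolding observation_def r_def[symmetric] by algebra
    then show ?thesis using assms unfolding r2 r_def[symmetric] by (simp add: field_simps)
  qed
  have lev: "T_tilde n m (observation n m \<theta> z) i = (\<Sum>j<2^i. (\<theta> i j)\<^sup>2) + (\<Sum>k=1..m. \<Sum>j<2^i. ?g k i j)" for i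
  proof -
    have "T_tilde n m (observation n m \<theta> z) i =
        (\<Sum>k=1..m. \<Sum>j<2^i. (observation n m \<theta> z k i j)\<^sup>2 / m) - 2 ^ i * m / n"
      unfolding T_tilde_def T_avg_def T_local_def
      by (simp add: sum_divide_distrib[symmetric])
    also have "\<dots> = (\<Sum>j<2^i. (\<theta> i j)\<^sup>2) + (\<Sum>k=1..m. \<Sum>j<2^i. ?g k i j)"
      unfolding pt using assms by (simp add: sum.distrib sum_divide_distrib[symmetric])
    finally show ?thesis .
  qed
  have "(\<Sum>i=l..l'. \<Sum>k=1..m. \<Sum>j<2^i. ?g k i j) = (\<Sum>k=1..m. \<Sum>i=l..l'. \<Sum>j<2^i. ?g k i j)"
    by (rule sum.swap)
  also have "\<dots> = (\<Sum>(k, i, j)\<in>{1..m} \<times> Sigma {l..l'} (\<lambda>i. {..<2^i}). ?g k i j)"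
    by (simp add: sum.Sigma)
  finally show ?thesis unfolding lev by (simp add: sum.distrib case_prod_beta)
qed

lemma sum_power_two_le: "(\<Sum>i=l..l'. (2::real) ^ i) \<le> 2 * 2 ^ l'"
proof -
  have "(\<Sum>i=l..l'. (2::real) ^ i) \<le> (\<Sum>i<Suc l'. 2 ^ i)"
    by (rule sum_mono2) auto
  also have "\<dots> \<le> 2 * 2 ^ l'" by (subst geometric_sum) auto
  finally show ?thesis .
qed

text \<open>The signal uses up at most one unit \<open>2 ^ l' / n\<close> of the threshold. As
  \<open>\<tau> > 2\<close>, the centred noise must exceed a further unit, and its variance is at
  most \<open>8 * m * 2 ^ l' / n^2\<close>.\<close>

lemma prob_T_tilde_overshoot_le:
  assumes "0 < n" "0 < m" "2 < \<tau>" "l \<le> l'"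
    and bias: "(\<Sum>i=l..l'. \<Sum>j<2^i. (\<theta> i j)\<^sup>2) \<le> 2 ^ l / n"
  shows "measure (noise m) {z \<in> space (noise m).
    \<tau> * 2 ^ l' / n < (\<Sum>i=l..l'. T_tilde n m (observation n m \<theta> z) i)} \<le> 8 * real m / 2 ^ l'"
proof -
  interpret prob_space "noise m" by (rule prob_space_noise)
  let ?S = "\<Sum>i=l..l'. \<Sum>j<2^i. (\<theta> i j)\<^sup>2"
  let ?A = "{1..m} \<times> Sigma {l..l'} (\<lambda>i. {..<(2::nat)^i})"
  define \<alpha> where "\<alpha> = (\<lambda>a. case a of (k::nat, i, j) \<Rightarrow> 2 * sqrt (m / n) / m * \<theta> i j)"
  let ?X = "\<lambda>z. \<Sum>a\<in>?A. \<alpha> a * z a + 1 / n * ((z a)\<^sup>2 - 1)"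
  let ?t = "2 ^ l' / real n"
  have A: "finite ?A" "?A \<subseteq> noise_index m" by (auto simp: noise_index_def)
  have meas: "(\<lambda>z. z a) \<in> borel_measurable (noise m)" if "a \<in> ?A" for a
    using A that by (intro measurable_noise_component) auto
  have X: "?X \<in> borel_measurable (noise m)"
    using meas
    by (intro borel_measurable_sum)
       (auto intro!: borel_measurable_add borel_measurable_times borel_measurable_diff borel_measurable_power)
  have pow: "(2::real) ^ l \<le> 2 ^ l'" using \<open>l \<le> l'\<close> by simp
  then have S: "?S \<le> ?t" using bias assms by (smt (verit) divide_right_mono of_nat_0_le_iff)
  have sub: "?t < ?X z" if "\<tau> * 2 ^ l' / n < (\<Sum>i=l..l'. T_tilde n m (observation n m \<theta> z) i)" for z
  proof -
    have "2 * ?t \<le> \<tau> * ?t" using \<open>2 < \<tau>\<close> by (intro mult_right_mono) auto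
    then show ?thesis
      using that S unfolding T_tilde_sum_decomposition[OF assms(1,2)] \<alpha>_def by simp
  qed
  have "prob {z \<in> space (noise m). \<tau> * 2 ^ l' / n < (\<Sum>i=l..l'. T_tilde n m (observation n m \<theta> z) i)}
      \<le> prob {z \<in> space (noise m). ?t < ?X z}"
    using X sub by (intro finite_measure_mono) auto
  also have "\<dots> \<le> (\<Sum>a\<in>?A. (\<alpha> a)\<^sup>2 + 2 * (1 / n)\<^sup>2) / ?t\<^sup>2"
    using assms by (intro prob_gaussian_chaos_le A) auto
  also have "\<dots> \<le> (8 * real m * 2 ^ l' / n\<^sup>2) / ?t\<^sup>2"
  proof (rule divide_right_mono)
    \<comment> \<open>The factor \<open>1 / m\<close> cancels on summing over the machines, so the
      linear part contributes only \<open>4 / n\<close> times the signal energy. The other half of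
      the constant 8 comes from the at most \<open>2 * m * 2 ^ l'\<close> quadratic terms.\<close>
    have sq: "(\<alpha> (k, i, j))\<^sup>2 = 4 / (n * m) * (\<theta> i j)\<^sup>2" for k i j
      using assms unfolding \<alpha>_def by (simp add: power_mult_distrib power_divide) (simp add: power2_eq_square)
    have "(\<Sum>a\<in>?A. (\<alpha> a)\<^sup>2) = (\<Sum>k=1..m. \<Sum>i=l..l'. \<Sum>j<2^i. (\<alpha> (k, i, j))\<^sup>2)"
      by (simp add: sum.Sigma case_prod_beta)
    also have "\<dots> = (\<Sum>k=1..m. \<Sum>i=l..l'. \<Sum>j<2^i. 4 / (n * m) * (\<theta> i j)\<^sup>2)"
      unfolding sq ..
    also have "\<dots> = 4 / n * ?S"
      using assms by (simp add: sum_distrib_left sum_divide_distrib)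
    also have "\<dots> \<le> 4 / n * ?t" using S by (intro mult_left_mono) auto
    finally have 1: "(\<Sum>a\<in>?A. (\<alpha> a)\<^sup>2) \<le> 4 * 2 ^ l' / n\<^sup>2" by (simp add: power2_eq_square)
    have "real (card ?A) = real m * (\<Sum>i=l..l'. 2 ^ i)" by (simp add: card_cartesian_product)
    also have "\<dots> \<le> real m * (2 * 2 ^ l')" by (intro mult_left_mono sum_power_two_le) auto
    finally have card: "real (card ?A) \<le> 2 * real m * 2 ^ l'" by simp
    have "(\<Sum>a\<in>?A. 2 * (1 / real n)\<^sup>2) = card ?A * (2 / n\<^sup>2)" by (simp add: power_divide)
    also have "\<dots> \<le> (2 * real m * 2 ^ l') * (2 / n\<^sup>2)" by (intro mult_right_mono card) auto
    finally have 2: "(\<Sum>a\<in>?A. 2 * (1 / real n)\<^sup>2) \<le> 4 * real m * 2 ^ l' / n\<^sup>2" by simp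
    have "4 * 2 ^ l' / (real n)\<^sup>2 \<le> 4 * real m * 2 ^ l' / (real n)\<^sup>2"
      using assms by (intro divide_right_mono) auto
    with 1 2 have "(\<Sum>a\<in>?A. (\<alpha> a)\<^sup>2) + (\<Sum>a\<in>?A. 2 * (1 / real n)\<^sup>2)
        \<le> 4 * real m * 2 ^ l' / (real n)\<^sup>2 + 4 * real m * 2 ^ l' / (real n)\<^sup>2"
      unfolding of_nat_power by linarith
    then show "(\<Sum>a\<in>?A. (\<alpha> a)\<^sup>2 + 2 * (1 / real n)\<^sup>2) \<le> 8 * real m * 2 ^ l' / n\<^sup>2"
      by (simp add: sum.distrib)
  qed simp
  also have "\<dots> = 8 * real m / 2 ^ l'" using assms by (simp add: power2_eq_square)
  finally show ?thesis .
qed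

section \<open>Measurability of the truncation level and of the bit count\<close>

lemma finite_levels: "finite (levels smin smax n)"
proof (rule finite_subset)
  show "levels smin smax n \<subseteq> {..nat \<lfloor>log 2 (real n) / (1 + 2 * smin)\<rfloor>}"
    unfolding levels_def by (auto simp: le_nat_floor)
qed simp

lemma finite_admissible_levels: "finite (admissible_levels smin smax \<tau> n m y)"
  by (rule finite_subset[OF _ finite_levels]) (auto simp: admissible_levels_def)

lemma pred_admissible_levels [measurable]:
  "Measurable.pred (noise m)
     (\<lambda>z. l \<in> admissible_levels smin smax \<tau> n m (observation n m \<theta> z))"
  unfolding admissible_levels_def using finite_levels by simp

lemma measurable_l_hat [measurable]:
  "(\<lambda>z. l_hat smin smax \<tau> n m (observation n m \<theta> z)) \<in> noise m \<rightarrow>\<^sub>M count_space UNIV"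
proof -
  \<comment> \<open>A minimum over a random set becomes the least number satisfying a measurable
    predicate, a form that the measurability prover handles.\<close>
  have eq: "l_hat smin smax \<tau> n m y =
      (if \<exists>l. l \<in> admissible_levels smin smax \<tau> n m y
       then LEAST l. l \<in> admissible_levels smin smax \<tau> n m y
       else nat \<lfloor>log 2 (real n) / (1 + 2 * smin)\<rfloor>)" for y
    unfolding l_hat_def using Least_Min[of "\<lambda>l. l \<in> admissible_levels smin smax \<tau> n m y"]
    by (auto simp: finite_admissible_levels)
  show ?thesis unfolding eq by measurable
qed

text \<open>A lower bound for the probability of the event in the theorem requires that event to be
  measurable, since \<open>measure\<close> assigns 0 to other sets.\<close>

lemma measurable_bits:
  assumes enc: "enc n \<in> borel \<rightarrow>\<^sub>M count_space UNIV" and k: "k \<in> {1..m}"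
  shows "(\<lambda>z. real (bits enc smin smax \<tau> n m (observation n m \<theta> z) k)) \<in> borel_measurable (noise m)"
proof -
  have len: "(\<lambda>z. length (enc n (f z))) \<in> noise m \<rightarrow>\<^sub>M count_space UNIV"
    if "f \<in> borel_measurable (noise m)" for f
    using measurable_compose[OF measurable_compose[OF that enc], of length] by simp
  let ?l = "\<lambda>z. l_hat smin smax \<tau> n m (observation n m \<theta> z)"
  have len_sum: "(\<lambda>z. \<Sum>i\<le>l. \<Sum>j<2 ^ i. length (enc n (observation n m \<theta> z k i j)))
      \<in> noise m \<rightarrow>\<^sub>M count_space UNIV" for l :: nat
    by (intro measurable_sum_nat len measurable_observation k) simp
  have [measurable]: "(\<lambda>z. \<Sum>i\<le>?l z. \<Sum>j<2 ^ i. length (enc n (observation n m \<theta> z k i j)))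
      \<in> noise m \<rightarrow>\<^sub>M count_space UNIV"
    \<comment> \<open>The random upper summation limit takes countably many values, so measurability
      at each fixed limit is enough.\<close>
    by (rule measurable_compose_countable[OF len_sum measurable_l_hat])
  have [measurable]: "(\<lambda>z. \<Sum>i\<in>levels smin smax n. length (enc n (T_local (observation n m \<theta> z) k i)))
      \<in> noise m \<rightarrow>\<^sub>M count_space UNIV"
    by (intro measurable_sum_nat len measurable_T_local k)
  have [measurable]: "(\<lambda>z. nat_bits (?l z)) \<in> noise m \<rightarrow>\<^sub>M count_space UNIV"
    by (rule measurable_compose[OF measurable_l_hat]) simp
  show ?thesis unfolding bits_def by measurable
qed

section \<open>Geometric tails and the union bound over the levels\<close>

lemma sum_powers_le:
  fixes F :: "nat set" and q :: real
  assumes "finite F" "\<And>i. i \<in> F \<Longrightarrow> l \<le> i" "0 \<le> q" "q < 1"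
  shows "(\<Sum>i\<in>F. q ^ i) \<le> q ^ l / (1 - q)"
proof -
  have sums: "(\<lambda>i. q ^ (i + l)) sums (q ^ l / (1 - q))"
    using sums_mult2[OF geometric_sums[of q], of "q ^ l"] assms by (simp add: power_add)
  \<comment> \<open>Shifting by \<open>l\<close> is injective on \<open>F\<close> because no element
    is below \<open>l\<close>; otherwise truncated subtraction could merge indices.\<close>
  have "(\<Sum>i\<in>F. q ^ i) = (\<Sum>i\<in>(\<lambda>i. i - l) ` F. q ^ (i + l))"
    using assms(2)
    by (subst sum.reindex) (auto intro!: sum.cong inj_onI dest: eq_diff_iff[THEN iffD1, rotated 2])
  also have "\<dots> \<le> (\<Sum>i. q ^ (i + l))"
    using assms sums by (intro sum_le_suminf) (auto simp: sums_iff)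
  finally show ?thesis using sums by (simp add: sums_iff)
qed

lemma sets_overshoot:
  "{z \<in> space (noise m). c < (\<Sum>i=l..l'. T_tilde n m (observation n m \<theta> z) i)} \<in> sets (noise m)"
  by measurable

text \<open>If no sum starting at \<open>l\<close> exceeds its threshold, then \<open>l\<close> is
  admissible, so the default value in \<open>l_hat\<close> is not reached and the minimum is at most
  \<open>l\<close>. The union bound over \<open>l'\<close> is geometric with ratio 1/2, which
  doubles the constant 8.\<close>

lemma prob_l_hat_gt_le:
  assumes "0 < n" "0 < m" "2 < \<tau>" "l \<in> levels smin smax n"
    and bias: "\<And>l'. (\<Sum>i=l..l'. \<Sum>j<2^i. (\<theta> i j)\<^sup>2) \<le> 2 ^ l / n"
  shows "measure (noise m) {z \<in> space (noise m).
    l < l_hat smin smax \<tau> n m (observation n m \<theta> z)} \<le> 16 * real m / 2 ^ l"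
proof -
  interpret prob_space "noise m" by (rule prob_space_noise)
  let ?F = "{l' \<in> levels smin smax n. l \<le> l'}"
  let ?E = "\<lambda>l'. {z \<in> space (noise m).
    \<tau> * 2 ^ l' / n < (\<Sum>i=l..l'. T_tilde n m (observation n m \<theta> z) i)}"
  have F: "finite ?F" using finite_levels by simp
  have "{z \<in> space (noise m). l < l_hat smin smax \<tau> n m (observation n m \<theta> z)} \<subseteq> (\<Union>l'\<in>?F. ?E l')"
  proof (intro subsetI, elim CollectE conjE, rule ccontr)
    fix z assume z: "z \<in> space (noise m)" "l < l_hat smin smax \<tau> n m (observation n m \<theta> z)"
      and "z \<notin> (\<Union>l'\<in>?F. ?E l')"
    then have "l \<in> admissible_levels smin smax \<tau> n m (observation n m \<theta> z)"
      unfolding admissible_levels_def using assms(4) by force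
    then have "l_hat smin smax \<tau> n m (observation n m \<theta> z) \<le> l"
      unfolding l_hat_def using finite_admissible_levels by (auto intro: Min_le)
    with z show False by simp
  qed
  then have "prob {z \<in> space (noise m). l < l_hat smin smax \<tau> n m (observation n m \<theta> z)}
      \<le> prob (\<Union>l'\<in>?F. ?E l')"
    by (intro finite_measure_mono sets.finite_UN F sets_overshoot) auto
  also have "\<dots> \<le> (\<Sum>l'\<in>?F. prob (?E l'))"
    by (intro finite_measure_subadditive_finite F) (auto intro!: sets_overshoot)
  also have "\<dots> \<le> (\<Sum>l'\<in>?F. 8 * real m / 2 ^ l')"
    using assms by (intro sum_mono prob_T_tilde_overshoot_le) auto
  also have "\<dots> = 8 * real m * (\<Sum>l'\<in>?F. (1 / 2) ^ l')"
    by (simp add: sum_distrib_left power_divide)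
  also have "\<dots> \<le> 8 * real m * ((1 / 2) ^ l / (1 - 1 / 2))"
    by (intro mult_left_mono sum_powers_le F) auto
  finally show ?thesis by (simp add: power_divide)
qed

subsection \<open>Message lengths\<close>

text \<open>Bounds the magnitude-dependent part of the messages of machine \<open>k\<close>. The
  deterministic \<open>l\<close> stands in for the random truncation level, which makes the
  expectation computable.\<close>

definition sent_energy where
  "sent_energy F l y k = (\<Sum>i\<in>F. T_local y k i) + (\<Sum>i\<le>l. \<Sum>j<2^i. (y k i j)\<^sup>2)"

lemma has_bochner_integral_sent_energy:
  assumes "k \<in> {1..m}"
  shows "has_bochner_integral (noise m) (\<lambda>z. sent_energy F l (observation n m \<theta> z) k)
    ((\<Sum>i\<in>F. (\<Sum>j<2^i. (\<theta> i j)\<^sup>2 + m / n) / 2 ^ i) + (\<Sum>i\<le>l. \<Sum>j<2^i. (\<theta> i j)\<^sup>2 + m / n))"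
proof -
  have "has_bochner_integral (noise m) (\<lambda>z. (observation n m \<theta> z k i j)\<^sup>2) ((\<theta> i j)\<^sup>2 + m / n)"
    if "j < 2 ^ i" for i j
  proof -
    define r where "r = sqrt (m / n)"
    have r2: "r\<^sup>2 = m / n" unfolding r_def by simp
    \<comment> \<open>The zero cubic and quartic terms match the shape of the fourth-degree moment
      formula.\<close>
    have *: "(observation n m \<theta> z k i j)\<^sup>2 =
        (\<theta> i j)\<^sup>2 + 2 * r * \<theta> i j * z (k, i, j) + r\<^sup>2 * (z (k, i, j))\<^sup>2
          + 0 * (z (k, i, j)) ^ 3 + 0 * (z (k, i, j)) ^ 4" for z
      unfolding observation_def r_def[symmetric] by algebra
    have "(k, i, j) \<in> noise_index m" using assms that by (auto simp: noise_index_def)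
    from has_bochner_integral_noise_component[OF this has_bochner_integral_std_normal_poly4]
    show ?thesis unfolding * r2[symmetric] by (rule back_subst[where P = "has_bochner_integral _ _"]) simp
  qed
  then show ?thesis unfolding sent_energy_def T_local_def
    by (intro has_bochner_integral_add has_bochner_integral_sum has_bochner_integral_divide_zero) auto
qed

lemma sent_energy_nonneg: "0 \<le> sent_energy F l y k"
  unfolding sent_energy_def T_local_def by (intro add_nonneg_nonneg sum_nonneg divide_nonneg_nonneg) auto

text \<open>Markov's inequality. Since \<open>m \<le> n\<close>, each squared observation has mean
  at most \<open>\<theta>^2 + 1\<close>; the first round thus contributes at most
  \<open>K + card F\<close> and the second at most \<open>K + 2 * 2 ^ l\<close>.\<close>

lemma prob_sent_energy_gt_le:
  assumes "finite F" and k: "k \<in> {1..m}" and "m \<le> n" "0 < t"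
    and energy: "\<And>G. finite G \<Longrightarrow> (\<Sum>i\<in>G. \<Sum>j<2^i. (\<theta> i j)\<^sup>2) \<le> K"
  shows "measure (noise m) {z \<in> space (noise m). t < sent_energy F l (observation n m \<theta> z) k}
    \<le> (2 * K + real (card F) + 2 * 2 ^ l) / t"
proof -
  interpret prob_space "noise m" by (rule prob_space_noise)
  let ?W = "\<lambda>z. sent_energy F l (observation n m \<theta> z) k"
  note W = has_bochner_integral_sent_energy[OF k, of F l n \<theta>]
  have mn: "real m / n \<le> 1" using assms by (simp add: divide_le_eq)
  have [measurable]: "?W \<in> borel_measurable (noise m)"
    using W by (auto dest: borel_measurable_has_bochner_integral)
  have "prob {z \<in> space (noise m). t < ?W z} \<le> prob {z \<in> space (noise m). t \<le> ?W z}"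
    by (intro finite_measure_mono) auto
  also have "\<dots> \<le> expectation ?W / t"
    by (rule integral_Markov_inequality_measure[where A = "{}"])
       (use W \<open>0 < t\<close> sent_energy_nonneg in \<open>auto simp: has_bochner_integral_iff\<close>)
  also have "\<dots> \<le> (2 * K + real (card F) + 2 * 2 ^ l) / t"
  proof (rule divide_right_mono)
    have sq: "(\<Sum>j<2^i. (\<theta> i j)\<^sup>2) / 2 ^ i \<le> (\<Sum>j<2^i. (\<theta> i j)\<^sup>2) / 1" for i
      by (intro divide_left_mono sum_nonneg) auto
    have "(\<Sum>i\<in>F. (\<Sum>j<2^i. (\<theta> i j)\<^sup>2 + m / n) / 2 ^ i)
        = (\<Sum>i\<in>F. (\<Sum>j<2^i. (\<theta> i j)\<^sup>2) / 2 ^ i + m / n)"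
      by (simp add: sum.distrib add_divide_distrib)
    also have "\<dots> \<le> (\<Sum>i\<in>F. (\<Sum>j<2^i. (\<theta> i j)\<^sup>2) + 1)"
      using sq mn by (intro sum_mono add_mono) auto
    also have "\<dots> \<le> K + real (card F)" using energy[OF \<open>finite F\<close>] by (simp add: sum.distrib)
    finally have 1: "(\<Sum>i\<in>F. (\<Sum>j<2^i. (\<theta> i j)\<^sup>2 + m / n) / 2 ^ i) \<le> K + real (card F)" .
    have "(\<Sum>i\<le>l. \<Sum>j<2^i. (\<theta> i j)\<^sup>2 + m / n) \<le> (\<Sum>i\<le>l. \<Sum>j<2^i. (\<theta> i j)\<^sup>2 + 1)"
      using mn by (intro sum_mono add_left_mono) auto
    also have "\<dots> = (\<Sum>i\<le>l. \<Sum>j<2^i. (\<theta> i j)\<^sup>2) + (\<Sum>i=0..l. 2 ^ i)"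
      by (simp add: sum.distrib atMost_atLeast0)
    also have "\<dots> \<le> K + 2 * 2 ^ l"
      using energy[of "{..l}"] sum_power_two_le[of 0 l] by (intro add_mono) auto
    finally have "(\<Sum>i\<le>l. \<Sum>j<2^i. (\<theta> i j)\<^sup>2 + m / n) \<le> K + 2 * 2 ^ l" .
    with 1 W show "expectation ?W \<le> 2 * K + real (card F) + 2 * 2 ^ l"
      by (simp add: has_bochner_integral_iff)
  qed (use \<open>0 < t\<close> in simp)
  finally show ?thesis .
qed

section \<open>Code lengths bounded by squared magnitudes\<close>

lemma log2_max_le:
  assumes "0 \<le> (t::real)"
  shows "log 2 (max 1 t) \<le> t"
proof (cases "t \<le> 1")
  case False
  \<comment> \<open>The tangent of \<open>ln\<close> at 1 is applied to \<open>t / 2\<close> rather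
    than \<open>t\<close>: the halved slope is below \<open>ln 2\<close>, and the offset
    \<open>ln 2 - 1\<close> is negative.\<close>
  have "ln (t / 2) \<le> t / 2 - 1" using False by (intro ln_le_minus_one) simp
  then have "ln t \<le> t / 2 - 1 + ln 2" using False by (simp add: ln_div)
  moreover have "t / 2 \<le> t * ln 2" using mult_left_mono[of "1 / 2" "ln 2" t] False ln2_ge_two_thirds by simp
  moreover have "ln 2 \<le> (1::real)" using ln_le_minus_one[of 2] by simp
  ultimately have "ln t \<le> t * ln 2" by linarith
  then show ?thesis using False by (simp add: log_def divide_le_eq)
qed (use assms in simp)

lemma log2_max_abs_le_square: "log 2 (max 1 \<bar>x\<bar>) \<le> x\<^sup>2"
proof (cases "\<bar>x\<bar> \<le> 1")
  case False
  have "log 2 (max 1 \<bar>x\<bar>) \<le> \<bar>x\<bar> * 1" using log2_max_le[of "\<bar>x\<bar>"] by simp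
  also have "\<dots> \<le> \<bar>x\<bar> * \<bar>x\<bar>" using False by (intro mult_left_mono) auto
  finally show ?thesis by (simp add: power2_eq_square)
qed (auto simp: max_def)

text \<open>\<open>real_code\<close> does not state the sign of \<open>c\<close>; it follows from
  the codeword of 0 at \<open>n = 2\<close>.\<close>

lemma real_code_const_nonneg:
  assumes "real_code D c enc"
  shows "0 \<le> c"
proof -
  have "0 \<le> real (length (enc 2 0))" by simp
  also have "\<dots> \<le> c * (log 2 (real 2) + log 2 (max 1 \<bar>0\<bar>))"
    using assms unfolding real_code_def by blast
  finally show ?thesis by simp
qed

text \<open>A crude bound suffices, because \<open>l + 1\<close> is later absorbed into
  \<open>2 ^ l\<close>.\<close>

lemma nat_bits_le: "nat_bits l \<le> l + 1"
proof -
  have "floorlog 2 l \<le> l" by (simp add: floorlog_le_iff)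
  then show ?thesis unfolding nat_bits_def by simp
qed

text \<open>Every transmitted number costs \<open>log 2 n\<close> plus its magnitude part, and the
  second round sends at most \<open>2 * 2 ^ l\<close> numbers. First-round statistics enter
  linearly, being averages of squares already; observations enter squared.\<close>

lemma bits_le:
  assumes "2 \<le> n" and code: "real_code D c enc" and l: "l_hat smin smax \<tau> n m y \<le> l"
  shows "real (bits enc smin smax \<tau> n m y k) \<le>
    c * (log 2 n * (real (card (levels smin smax n)) + 2 * 2 ^ l) + sent_energy (levels smin smax n) l y k)
    + l + 1"
proof -
  have len: "real (length (enc n x)) \<le> c * (log 2 n + log 2 (max 1 \<bar>x\<bar>))" for x
    using code \<open>2 \<le> n\<close> by (auto simp: real_code_def)
  have c: "0 \<le> c" by (rule real_code_const_nonneg[OF code])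
  have len_sq: "real (length (enc n x)) \<le> c * (log 2 n + x\<^sup>2)" for x
    by (rule order_trans[OF len]) (intro mult_left_mono add_left_mono log2_max_abs_le_square c)
  have len_T: "real (length (enc n (T_local y k i))) \<le> c * (log 2 n + T_local y k i)" for i
  proof (rule order_trans[OF len], intro mult_left_mono add_left_mono c)
    have "0 \<le> T_local y k i" unfolding T_local_def by (intro divide_nonneg_nonneg sum_nonneg) auto
    then show "log 2 (max 1 \<bar>T_local y k i\<bar>) \<le> T_local y k i"
      using log2_max_le by simp
  qed
  let ?S = "levels smin smax n"
  have "real (bits enc smin smax \<tau> n m y k) = (\<Sum>i\<in>?S. real (length (enc n (T_local y k i))))
     + nat_bits (l_hat smin smax \<tau> n m y)
     + (\<Sum>i\<le>l_hat smin smax \<tau> n m y. \<Sum>j<2 ^ i. real (length (enc n (y k i j))))"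
    by (simp add: bits_def)
  also have "\<dots> \<le> (\<Sum>i\<in>?S. c * (log 2 n + T_local y k i)) + (real l + 1)
     + (\<Sum>i\<le>l. \<Sum>j<2 ^ i. c * (log 2 n + (y k i j)\<^sup>2))"
  proof (intro add_mono)
    show "(\<Sum>i\<in>?S. real (length (enc n (T_local y k i)))) \<le> (\<Sum>i\<in>?S. c * (log 2 n + T_local y k i))"
      by (intro sum_mono len_T)
    show "real (nat_bits (l_hat smin smax \<tau> n m y)) \<le> real l + 1"
      using nat_bits_le[of "l_hat smin smax \<tau> n m y"] l by linarith
    have "(\<Sum>i\<le>l_hat smin smax \<tau> n m y. \<Sum>j<2 ^ i. real (length (enc n (y k i j))))
        \<le> (\<Sum>i\<le>l. \<Sum>j<2 ^ i. real (length (enc n (y k i j))))"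
      using l by (intro sum_mono2 sum_nonneg) auto
    also have "\<dots> \<le> (\<Sum>i\<le>l. \<Sum>j<2 ^ i. c * (log 2 n + (y k i j)\<^sup>2))"
      by (intro sum_mono len_sq)
    finally show "(\<Sum>i\<le>l_hat smin smax \<tau> n m y. \<Sum>j<2 ^ i. real (length (enc n (y k i j)))) \<le> \<dots>" .
  qed
  also have "\<dots> = c * (log 2 n * (real (card ?S) + (\<Sum>i=0..l. 2 ^ i)) + sent_energy ?S l y k) + l + 1"
    by (simp add: sent_energy_def sum_distrib_left[symmetric] sum_distrib_right[symmetric] sum.distrib
        algebra_simps atMost_atLeast0)
  also have "\<dots> \<le> c * (log 2 n * (real (card ?S) + 2 * 2 ^ l) + sent_energy ?S l y k) + l + 1"
    using \<open>2 \<le> n\<close> by (intro add_right_mono mult_left_mono add_left_mono sum_power_two_le[of 0] c) auto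
  finally show ?thesis .
qed

text \<open>The bit count can exceed \<open>R\<close> only if \<open>l_hat\<close> exceeds
  \<open>l\<close> or the energy exceeds \<open>t\<close>. The level \<open>t\<close> stays free, to
  be balanced against the bit budget.\<close>

lemma prob_bits_le_ge:
  assumes "2 \<le> n" "m \<le> n" "2 < \<tau>" "real_code D c enc" "k \<in> {1..m}" "0 < t"
    and l: "l \<in> levels smin smax n"
    and bias: "\<And>l'. (\<Sum>i=l..l'. \<Sum>j<2^i. (\<theta> i j)\<^sup>2) \<le> 2 ^ l / n"
    and energy: "\<And>G. finite G \<Longrightarrow> (\<Sum>i\<in>G. \<Sum>j<2^i. (\<theta> i j)\<^sup>2) \<le> K"
    and R: "c * (log 2 n * (real (card (levels smin smax n)) + 2 * 2 ^ l) + t) + l + 1 \<le> R"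
  shows "1 - 16 * real m / 2 ^ l - (2 * K + real (card (levels smin smax n)) + 2 * 2 ^ l) / t
    \<le> measure (noise m) {z \<in> space (noise m).
        real (bits enc smin smax \<tau> n m (observation n m \<theta> z) k) \<le> R}"
proof -
  interpret prob_space "noise m" by (rule prob_space_noise)
  have c: "0 \<le> c" by (rule real_code_const_nonneg[OF assms(4)])
  let ?S = "levels smin smax n"
  let ?good = "{z \<in> space (noise m). real (bits enc smin smax \<tau> n m (observation n m \<theta> z) k) \<le> R}"
  let ?A = "{z \<in> space (noise m). l < l_hat smin smax \<tau> n m (observation n m \<theta> z)}"
  let ?B = "{z \<in> space (noise m). t < sent_energy ?S l (observation n m \<theta> z) k}"
  have [measurable]: "(\<lambda>z. real (bits enc smin smax \<tau> n m (observation n m \<theta> z) k)) \<in> borel_measurable (noise m)"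
    using assms by (intro measurable_bits) (auto simp: real_code_def)
  have [measurable]: "(\<lambda>z. sent_energy ?S l (observation n m \<theta> z) k) \<in> borel_measurable (noise m)"
    using has_bochner_integral_sent_energy[OF assms(5)] by (auto dest: borel_measurable_has_bochner_integral)
  have sets: "?good \<in> events" "?A \<in> events" "?B \<in> events" by measurable
  have "space (noise m) \<subseteq> ?good \<union> (?A \<union> ?B)"
  proof
    fix z assume z: "z \<in> space (noise m)"
    show "z \<in> ?good \<union> (?A \<union> ?B)"
    proof (cases "z \<in> ?A \<union> ?B")
      case False
      then have *: "l_hat smin smax \<tau> n m (observation n m \<theta> z) \<le> l"
        "sent_energy ?S l (observation n m \<theta> z) k \<le> t" using z by auto
      from * c have "c * (log 2 n * (real (card ?S) + 2 * 2 ^ l) + sent_energy ?S l (observation n m \<theta> z) k) + l + 1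
          \<le> c * (log 2 n * (real (card ?S) + 2 * 2 ^ l) + t) + l + 1"
        by (intro add_right_mono mult_left_mono add_left_mono)
      with bits_le[OF assms(1,4) *(1), of k] R show ?thesis using z by auto
    qed auto
  qed
  then have "prob (space (noise m)) \<le> prob (?good \<union> (?A \<union> ?B))"
    using sets by (intro finite_measure_mono) auto
  also have "\<dots> \<le> prob ?good + (prob ?A + prob ?B)"
    using sets by (intro order_trans[OF measure_Un_le] add_left_mono measure_Un_le) auto
  also have "prob ?A \<le> 16 * real m / 2 ^ l"
    using assms by (intro prob_l_hat_gt_le) auto
  also have "prob ?B \<le> (2 * K + real (card ?S) + 2 * 2 ^ l) / t"
    using assms finite_levels by (intro prob_sent_energy_gt_le) auto
  finally show ?thesis by (simp add: prob_space)
qed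

subsection \<open>Asymptotics over the Besov ball\<close>

lemma card_levels_le:
  assumes "1 \<le> n" "0 < smin"
  shows "real (card (levels smin smax n)) \<le> log 2 n + 1"
proof -
  have 0: "0 \<le> log 2 (real n)" using assms by simp
  have "log 2 n / (1 + 2 * smin) \<le> log 2 n / 1"
    using assms by (intro divide_left_mono 0) auto
  then have "levels smin smax n \<subseteq> {..nat \<lfloor>log 2 (real n)\<rfloor>}"
    unfolding levels_def by (auto simp: le_nat_floor)
  then have "card (levels smin smax n) \<le> nat \<lfloor>log 2 (real n)\<rfloor> + 1"
    using card_mono[of "{..nat \<lfloor>log 2 (real n)\<rfloor>}"] by auto
  then show ?thesis using of_nat_floor[OF 0] by linarith
qed

lemma besov_ball_level_energy:
  assumes "f \<in> besov_ball \<psi> s L"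
  shows "(\<Sum>j<2 ^ i. (coeff_of \<psi> f i j)\<^sup>2) \<le> L * (2 powr (- 2 * s)) ^ i"
proof -
  let ?S = "\<Sum>j<2 ^ i. (coeff_of \<psi> f i j)\<^sup>2"
  have "ereal (2 powr (2 * real i * s) * ?S) \<le> ereal L"
    using assms by (auto simp: besov_ball_def SUP_le_iff)
  then have le: "2 powr (2 * real i * s) * ?S \<le> L" by simp
  have "?S = (2 powr (2 * real i * s) * ?S) * 2 powr (- (2 * real i * s))"
    by (simp add: powr_minus)
  also have "\<dots> \<le> L * 2 powr (- (2 * real i * s))" by (intro mult_right_mono le) simp
  also have "2 powr (- (2 * real i * s)) = (2 powr (- 2 * s)) ^ i"
    by (simp add: powr_realpow[symmetric] powr_powr mult_ac)
  finally show ?thesis .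
qed

text \<open>The level bounds form a geometric series. With \<open>l = 0\<close> this bounds the
  total energy, and at the cutoff level it bounds the bias.\<close>

lemma besov_ball_energy:
  assumes "f \<in> besov_ball \<psi> s L" "0 \<le> L" "0 < s" "finite G" "\<And>i. i \<in> G \<Longrightarrow> l \<le> i"
  shows "(\<Sum>i\<in>G. \<Sum>j<2 ^ i. (coeff_of \<psi> f i j)\<^sup>2)
    \<le> L / (1 - 2 powr (- 2 * s)) * (2 powr (- 2 * s)) ^ l"
proof -
  let ?q = "(2::real) powr (- 2 * s)"
  have q: "?q < 1" using powr_less_mono[of "- 2 * s" 0 2] \<open>0 < s\<close> by simp
  have "(\<Sum>i\<in>G. \<Sum>j<2 ^ i. (coeff_of \<psi> f i j)\<^sup>2) \<le> (\<Sum>i\<in>G. L * ?q ^ i)"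
    by (intro sum_mono besov_ball_level_energy assms)
  also have "\<dots> = L * (\<Sum>i\<in>G. ?q ^ i)" by (simp add: sum_distrib_left)
  also have "\<dots> \<le> L * (?q ^ l / (1 - ?q))"
    using assms q by (intro mult_left_mono sum_powers_le) auto
  finally show ?thesis by (simp add: field_simps)
qed

text \<open>Shows that the infimum in the theorem is over a nonempty set.\<close>

lemma zero_in_besov_ball: "0 \<le> L \<Longrightarrow> (\<lambda>_. 0) \<in> besov_ball \<psi> s L"
  by (simp add: besov_ball_def L2_unit_def coeff_of_def zero_ereal_def[symmetric])

section \<open>The deterministic cutoff level\<close>

text \<open>\<open>l\<close> is the least natural number with
  \<open>2 powr ((1 + 2 * s) * l) \<ge> K * n\<close>, which rearranges to the third claim. Rounding
  up costs the factor 2, and \<open>K powr (1 / (1 + 2 * s)) \<le> K\<close> because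
  \<open>K \<ge> 1\<close>.\<close>

lemma cutoff_level_bounds:
  fixes K s :: real
  assumes "1 \<le> K" "0 < s" "1 \<le> n"
  defines "l \<equiv> nat \<lceil>log 2 (K * n) / (1 + 2 * s)\<rceil>"
  shows "real n powr (1 / (1 + 2 * s)) \<le> 2 ^ l"
    and "2 ^ l \<le> 2 * K * n powr (1 / (1 + 2 * s))"
    and "K * (2 powr (- 2 * s)) ^ l \<le> 2 ^ l / n"
proof -
  let ?x = "log 2 (K * n) / (1 + 2 * s)" and ?b = "1 / (1 + 2 * s)"
  have Kn: "1 \<le> K * n" using assms mult_mono[of 1 K 1 "real n"] by simp
  then have x0: "0 \<le> ?x" using \<open>0 < s\<close> by simp
  then have l: "?x \<le> l" "l \<le> ?x + 1" unfolding l_def by linarith+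
  have pow: "(2::real) ^ l = 2 powr l" by (simp add: powr_realpow)
  have "2 powr ?x = (2 powr log 2 (K * n)) powr ?b" by (simp add: powr_powr)
  also have "\<dots> = (K * n) powr ?b" using Kn by simp
  finally have x: "2 powr ?x = K powr ?b * n powr ?b" using assms by (simp add: powr_mult)
  have "1 * n powr ?b \<le> K powr ?b * n powr ?b"
    using assms by (intro mult_right_mono ge_one_powr_ge_zero) auto
  also have "\<dots> \<le> 2 powr l" unfolding x[symmetric] using l by simp
  finally show "n powr ?b \<le> 2 ^ l" unfolding pow by simp
  have "2 powr l \<le> 2 powr (?x + 1)" using l by simp
  also have "\<dots> = 2 * (K powr ?b * n powr ?b)" unfolding powr_add x by simp
  also have "\<dots> \<le> 2 * (K powr 1 * n powr ?b)"
    using assms by (intro mult_left_mono mult_right_mono powr_mono) auto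
  finally show "2 ^ l \<le> 2 * K * n powr ?b" unfolding pow using assms by simp
  have "K * n = 2 powr log 2 (K * n)" using Kn by simp
  also have "\<dots> \<le> 2 powr ((1 + 2 * s) * l)"
    using l(1) \<open>0 < s\<close> by (simp add: divide_le_eq mult.commute)
  also have "\<dots> = 2 ^ l * 2 powr (2 * s * l)" unfolding pow by (simp add: powr_add[symmetric] algebra_simps)
  finally have "K * n * 2 powr (- (2 * s * l)) \<le> 2 ^ l * 2 powr (2 * s * l) * 2 powr (- (2 * s * l))"
    by (rule mult_right_mono) simp
  also have "\<dots> = 2 ^ l" by (simp add: powr_add[symmetric])
  finally have "K * n * 2 powr (- (2 * s * l)) \<le> 2 ^ l" .
  moreover have "2 powr (- (2 * s * l)) = (2 powr (- 2 * s)) ^ l"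
    by (simp add: powr_realpow[symmetric] powr_powr mult_ac)
  ultimately show "K * (2 powr (- 2 * s)) ^ l \<le> 2 ^ l / n"
    using assms by (simp add: field_simps)
qed

lemma cutoff_level_in_levels:
  fixes K s :: real
  assumes "1 \<le> K" "0 < smin" "smin < s" "s < smax"
  shows "\<forall>\<^sub>F n in sequentially. nat \<lceil>log 2 (K * real n) / (1 + 2 * s)\<rceil> \<in> levels smin smax n"
proof -
  \<comment> \<open>The gap \<open>e * log 2 n\<close> to the upper end of \<open>levels\<close>
    eventually absorbs both the offset from \<open>K\<close> and the rounding. The lower end is
    respected for every \<open>n \<ge> 1\<close>, because \<open>s < smax\<close>.\<close>
  define e where "e = 1 / (1 + 2 * smin) - 1 / (1 + 2 * s)"
  have "e > 0" unfolding e_def using assms by (simp add: frac_less2)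
  then have "\<forall>\<^sub>F n in sequentially. log 2 K / (1 + 2 * s) + 1 \<le> e * log 2 (real n)"
    by real_asymp
  then show ?thesis using eventually_ge_at_top[of 1]
  proof eventually_elim
    case (elim n)
    let ?x = "log 2 (K * real n) / (1 + 2 * s)"
    have n: "1 \<le> real n" using elim by simp
    have split: "log 2 (K * n) = log 2 K + log 2 n" using assms n by (simp add: log_mult)
    have pos: "0 \<le> log 2 K" "0 \<le> log 2 n" using assms n by auto
    have "log 2 n / (1 + 2 * smax) \<le> log 2 (K * n) / (1 + 2 * s)"
      using assms pos split by (intro frac_le) auto
    moreover have "?x \<le> nat \<lceil>?x\<rceil>" by linarith
    moreover have "0 \<le> ?x" using pos split assms by simp
    then have "nat \<lceil>?x\<rceil> \<le> ?x + 1" by linarith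
    moreover have "?x + 1 \<le> log 2 n / (1 + 2 * smin)"
      using elim(1) unfolding split e_def by (simp add: add_divide_distrib left_diff_distrib)
    ultimately show ?case by (auto simp: levels_def)
  qed
qed

text \<open>\<open>C\<close> is fixed before the sequences \<open>m\<close> and \<open>k\<close>. As
  \<open>k\<close> may pick the worst machine for each \<open>n\<close>, the convergence is uniform
  over the machines.\<close>

theorem theorem4p2:
  fixes smin smax L \<tau> D c :: real
    and \<psi> :: "nat \<Rightarrow> nat \<Rightarrow> real \<Rightarrow> real"
    and enc :: "nat \<Rightarrow> real \<Rightarrow> bool list"
  assumes "0 < smin" and "smin < smax" and "0 < L" and "2 < \<tau>"
    and "orthonormal_basis \<psi>"
    and "0 < D" and "real_code D c enc"
  shows "\<forall>s. smin < s \<and> s < smax \<longrightarrow>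
    (\<exists>C>0. \<forall>m k :: nat \<Rightarrow> nat.
       (\<forall>n\<ge>1. 1 \<le> m n \<and> real (m n) \<le> real n powr (1 / (1 + 2 * smax)) \<and> k n \<in> {1..m n}) \<longrightarrow>
       (\<lambda>n. INF f\<in>besov_ball \<psi> s L.
          measure (noise (m n))
            {z \<in> space (noise (m n)).
               real (bits enc smin smax \<tau> n (m n) (observation n (m n) (coeff_of \<psi> f) z) (k n))
                 \<le> C * ln (real n) * real n powr (1 / (1 + 2 * s))})
       \<longlonglongrightarrow> 1)"
proof (intro allI impI, elim conjE)
  fix s assume s: "smin < s" "s < smax"
  then have "0 < s" using assms by simp
  define q where "q = (2::real) powr (- 2 * s)"
  \<comment> \<open>The constant of the Besov tail, raised to at least 1 so that
    \<open>log 2 K\<close> is nonnegative.\<close>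
  define K where "K = max 1 (L / (1 - q))"
  define a where "a = 1 / (1 + 2 * smax)"
  define b where "b = 1 / (1 + 2 * s)"
  \<comment> \<open>With \<open>N = n powr b\<close>: the outer 2 is from
    \<open>log 2 n \<le> 2 * ln n\<close>, the \<open>1 + 4 * K\<close> from at most
    \<open>N\<close> levels and \<open>2 * 2 ^ l \<le> 4 * K * N\<close>, the next 1 from the energy
    level \<open>ln n * N\<close>, and the final \<open>2 * K\<close> from
    \<open>l + 1 \<le> 2 ^ l\<close>.\<close>
  define C where "C = c * (2 * (1 + 4 * K) + 1) + 2 * K"
  have q: "0 < q" "q < 1"
    using powr_less_mono[of "- 2 * s" 0 2] \<open>0 < s\<close> by (auto simp: q_def)
  have K: "1 \<le> K" "L / (1 - q) \<le> K" by (auto simp: K_def)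
  have c: "0 \<le> c" by (rule real_code_const_nonneg[OF assms(7)])
  have "0 < C" unfolding C_def using c K by (intro add_nonneg_pos) auto
  have ab: "a < b" "0 < a" "0 < b" "a \<le> 1" using s assms by (auto simp: a_def b_def frac_less2)
  show "\<exists>C>0. \<forall>m k :: nat \<Rightarrow> nat.
       (\<forall>n\<ge>1. 1 \<le> m n \<and> real (m n) \<le> real n powr (1 / (1 + 2 * smax)) \<and> k n \<in> {1..m n}) \<longrightarrow>
       (\<lambda>n. INF f\<in>besov_ball \<psi> s L.
          measure (noise (m n))
            {z \<in> space (noise (m n)).
               real (bits enc smin smax \<tau> n (m n) (observation n (m n) (coeff_of \<psi> f) z) (k n))
                 \<le> C * ln (real n) * real n powr (1 / (1 + 2 * s))})
       \<longlonglongrightarrow> 1"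
    unfolding a_def[symmetric] b_def[symmetric]
  proof (intro exI[of _ C] conjI allI impI \<open>0 < C\<close>)
    fix m k :: "nat \<Rightarrow> nat"
    assume mk: "\<forall>n\<ge>1. 1 \<le> m n \<and> real (m n) \<le> real n powr a \<and> k n \<in> {1..m n}"
    define P where "P = (\<lambda>n f. measure (noise (m n)) {z \<in> space (noise (m n)).
      real (bits enc smin smax \<tau> n (m n) (observation n (m n) (coeff_of \<psi> f) z) (k n))
        \<le> C * ln (real n) * real n powr b})"
    define l where "l = (\<lambda>n. nat \<lceil>log 2 (K * real n) / (1 + 2 * s)\<rceil>)"
    \<comment> \<open>The first term bounds the probability of overshooting the cutoff and vanishes
      because \<open>a < b\<close>; the second is the Markov bound. Neither depends on
      \<open>f\<close>, so the estimate passes to the infimum.\<close>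
    define \<epsilon> where "\<epsilon> = (\<lambda>n. 16 * real n powr a / real n powr b + (6 * K + 1) / ln (real n))"
    have lim: "(\<lambda>n. 1 - \<epsilon> n) \<longlonglongrightarrow> 1"
      unfolding \<epsilon>_def using ab by real_asymp
    have lower: "\<forall>\<^sub>F n in sequentially. \<forall>f\<in>besov_ball \<psi> s L. 1 - \<epsilon> n \<le> P n f"
    proof -
      have "\<forall>\<^sub>F n in sequentially. l n \<in> levels smin smax n"
        unfolding l_def using K s assms by (intro cutoff_level_in_levels)
      moreover have "\<forall>\<^sub>F n in sequentially. log 2 (real n) + 1 \<le> real n powr b"
        using ab by real_asymp
      moreover have "\<forall>\<^sub>F n in sequentially. 1 \<le> ln (real n)" by real_asymp
      ultimately show ?thesis using eventually_ge_at_top[of 2]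
      proof eventually_elim
        case (elim n)
        let ?N = "real n powr b" and ?k = "real (card (levels smin smax n))"
        have n: "1 \<le> n" using elim by simp
        note mkn = mk[rule_format, OF n]
        have l: "?N \<le> 2 ^ l n" "2 ^ l n \<le> 2 * K * ?N" "K * q ^ l n \<le> 2 ^ l n / n"
          unfolding l_def b_def q_def by (rule cutoff_level_bounds[OF K(1) \<open>0 < s\<close> n])+
        have N: "1 \<le> ?N" using n ab by (intro ge_one_powr_ge_zero) auto
        have card: "?k \<le> ?N"
          using card_levels_le[OF n \<open>0 < smin\<close>, of smax] elim(2) by linarith
        have "real (m n) \<le> real n powr 1"
          using mkn ab n by (intro order_trans[OF _ powr_mono[of a 1]]) auto
        then have mn: "m n \<le> n" by simp
        have log2: "log 2 (real n) \<le> 2 * ln (real n)"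
        proof -
          have "ln (real n) * 1 \<le> ln (real n) * (2 * ln 2)"
            using elim(3) ln2_ge_two_thirds by (intro mult_left_mono) auto
          then show ?thesis by (simp add: log_def divide_le_eq)
        qed
        have R: "c * (log 2 n * (?k + 2 * 2 ^ l n) + ln n * ?N) + l n + 1 \<le> C * ln n * ?N"
        proof -
          have "log 2 n * (?k + 2 * 2 ^ l n) \<le> (2 * ln n) * (?N + 2 * (2 * K * ?N))"
            using log2 card l(2) elim(3) by (intro mult_mono add_mono mult_left_mono) auto
          then have "c * (log 2 n * (?k + 2 * 2 ^ l n) + ln n * ?N)
              \<le> c * ((2 * ln n) * (?N + 2 * (2 * K * ?N)) + ln n * ?N)"
            by (intro mult_left_mono add_right_mono c)
          moreover have "real (l n) + 1 \<le> 2 ^ l n"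
          proof -
            have "Suc (l n) \<le> 2 ^ l n" by (simp add: Suc_leI)
            then have "real (Suc (l n)) \<le> real (2 ^ l n)" by (rule of_nat_mono)
            then show ?thesis by simp
          qed
          moreover have "2 * K * ?N * 1 \<le> 2 * K * ?N * ln n"
            using elim(3) K N by (intro mult_left_mono) auto
          ultimately show ?thesis using l(2) unfolding C_def by (simp add: algebra_simps)
        qed
        show ?case
        proof
          fix f assume f: "f \<in> besov_ball \<psi> s L"
          note energy = besov_ball_energy[OF f less_imp_le[OF \<open>0 < L\<close>] \<open>0 < s\<close>, folded q_def]
          have "1 - 16 * real (m n) / 2 ^ l n - (2 * K + ?k + 2 * 2 ^ l n) / (ln n * ?N) \<le> P n f"
            unfolding P_def
          \<comment> \<open>The energy level is \<open>ln n * N\<close>: larger than the order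
            \<open>N\<close> of the mean by a factor \<open>ln n\<close>, which makes Markov's bound
            vanish, yet still within the bit budget.\<close>
          proof (rule prob_bits_le_ge[where D = D and c = c and l = "l n"])
            show "(\<Sum>i=l n..l'. \<Sum>j<2^i. (coeff_of \<psi> f i j)\<^sup>2) \<le> 2 ^ l n / n" for l'
            proof -
              have "(\<Sum>i=l n..l'. \<Sum>j<2^i. (coeff_of \<psi> f i j)\<^sup>2) \<le> L / (1 - q) * q ^ l n"
                by (rule energy) auto
              also have "\<dots> \<le> K * q ^ l n" using q by (intro mult_right_mono K) auto
              also note l(3)
              finally show ?thesis .
            qed
            show "(\<Sum>i\<in>G. \<Sum>j<2^i. (coeff_of \<psi> f i j)\<^sup>2) \<le> K" if "finite G" for G
              using energy[OF that, of 0] K(2) by simp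
            show "0 < ln (real n) * ?N" using elim(3) N by (intro mult_pos_pos) linarith+
          qed (use elim mn mkn assms R in auto)
          moreover have "16 * real (m n) / 2 ^ l n \<le> 16 * real n powr a / ?N"
            using mkn l(1) n by (intro frac_le) auto
          moreover have "(2 * K + ?k + 2 * 2 ^ l n) / (ln n * ?N) \<le> (6 * K + 1) / ln n"
          proof -
            have "2 * K * 1 \<le> 2 * K * ?N" using N K by (intro mult_left_mono) auto
            then have "2 * K + ?k + 2 * 2 ^ l n \<le> (6 * K + 1) * ?N"
              using card l(2) by (simp add: algebra_simps)
            then have "(2 * K + ?k + 2 * 2 ^ l n) / (ln n * ?N) \<le> (6 * K + 1) * ?N / (ln n * ?N)"
              using elim(3) by (intro divide_right_mono) auto
            then show ?thesis using n by simp
          qed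
          ultimately show "1 - \<epsilon> n \<le> P n f" unfolding \<epsilon>_def by linarith
        qed
      qed
    qed
    have ne: "(\<lambda>_. 0) \<in> besov_ball \<psi> s L" using assms by (intro zero_in_besov_ball) simp
    have upper: "(INF f\<in>besov_ball \<psi> s L. P n f) \<le> 1" for n
    proof -
      interpret prob_space "noise (m n)" by (rule prob_space_noise)
      \<comment> \<open>A real infimum is below its members only if the family is bounded below;
        here 0 is a lower bound.\<close>
      have "(INF f\<in>besov_ball \<psi> s L. P n f) \<le> P n (\<lambda>_. 0)"
        by (rule cINF_lower[OF _ ne]) (auto simp: P_def intro: bdd_belowI2[where m = 0])
      also have "\<dots> \<le> 1" unfolding P_def by simp
      finally show ?thesis .
    qed
    have "(\<lambda>n. INF f\<in>besov_ball \<psi> s L. P n f) \<longlonglongrightarrow> 1"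
    proof (rule tendsto_sandwich[OF _ _ lim tendsto_const])
      show "\<forall>\<^sub>F n in sequentially. 1 - \<epsilon> n \<le> (INF f\<in>besov_ball \<psi> s L. P n f)"
        using lower by eventually_elim (use ne in \<open>auto intro!: cINF_greatest\<close>)
      show "\<forall>\<^sub>F n in sequentially. (INF f\<in>besov_ball \<psi> s L. P n f) \<le> 1"
        using upper by simp
    qed
    then show "(\<lambda>n. INF f\<in>besov_ball \<psi> s L. measure (noise (m n)) {z \<in> space (noise (m n)).
      real (bits enc smin smax \<tau> n (m n) (observation n (m n) (coeff_of \<psi> f) z) (k n))
        \<le> C * ln (real n) * real n powr b}) \<longlonglongrightarrow> 1"
      unfolding P_def .
  qed
qed

end
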